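(* Let $0<s<1$ and $1<p<\infty$ satisfy $sp<1$. Then the cube $G=(0,1)^n\subset\mathbb{R}^n$ does not admit an $(s,p)$-zero extension, and $\mathrm{cap}_{s,p}(\cdot,G)$ is $\mathcal{W}(G)$-quasiadditive.
   Context: $C_c(G)$ denotes the space of (real-valued) continuous functions with compact support in $G$. For an open set $G\subset\mathbb{R}^n$ and a measurable function $u$ on $G$, put $$|u|_{W^{s,p}(G)}=\left(\int_G\int_G\frac{|u(x)-u(y)|^p}{|x-y|^{n+sp}}\,dy\,dx\right)^{1/p}\in[0,\infty].$$ Capacity: for a compact set $K\subset G$, $\mathrm{cap}_{s,p}(K,G)=\inf_u |u|_{W^{s,p}(G)}^p$, where the infimum ranges over all real-valued $u\in C_c(G)$ such that $u(x)\ge 1$ for every $x\in K$. Whitney cubes: for an open set $\emptyset\neq G\subsetneq\mathbb{R}^n$, $\mathcal{W}(G)$ is a fixed (standard) Whitney decomposition of $G$: a family of closed dyadic cubes with pairwise disjoint interiors such that $G=\bigcup_{Q\in\mathcal{W}(G)}Q$, $\mathrm{diam}(Q)\le\mathrm{dist}(Q,\partial G)\le 4\,\mathrm{diam}(Q)$ for each $Q\in\mathcal{W}(G)$, and $\sum_{Q\in\mathcal{W}(G)}\chi_{Q^{**}}\le C_n\chi_G$, where $Q^{**}=\tfrac98 Q$ is the concentric dilation of $Q$ and $C_n$ depends only on $n$. Quasiadditivity: $\mathrm{cap}_{s,p}(\cdot,G)$ is $\mathcal{W}(G)$-quasiadditive if there is a constant $N>0$ such that for every compact set $K\subset G$, $$\sum_{Q\in\mathcal{W}(G)}\mathrm{cap}_{s,p}(K\cap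 Q,G)\le N\,\mathrm{cap}_{s,p}(K,G).$$ Zero extension: $G$ admits an $(s,p)$-zero extension if there is a constant $C>0$ such that $|E_Gu|_{W^{s,p}(\mathbb{R}^n)}\le C\,|u|_{W^{s,p}(G)}$ for every $u\in C_c(G)$, where $E_Gu(x)=u(x)$ if $x\in G$ and $E_Gu(x)=0$ otherwise. *)

theory Defs
  imports "HOL-Analysis.Analysis"
begin

text \<open>
  Functions on an open set \<open>G\<close> are represented by total functions on \<open>real ^ 'n\<close>.
  All notions below depend only on their values on \<open>G\<close>.
\<close>

(* Only meant for exponents r > 0, so that the value at infinity is infinity. *)
definition ennreal_powr :: "ennreal \<Rightarrow> real \<Rightarrow> ennreal" where
  "ennreal_powr a r = (if a = top then top else ennreal (enn2real a powr r))"

(* On the diagonal x = y, which is a null set, the integrand evaluates to 0 / 0 = 0. *)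
definition sobolev_seminorm ::
    "real \<Rightarrow> real \<Rightarrow> (real ^ 'n) set \<Rightarrow> (real ^ 'n \<Rightarrow> real) \<Rightarrow> ennreal" where
  "sobolev_seminorm s p G u =
     ennreal_powr
       (\<integral>\<^sup>+x\<in>G. (\<integral>\<^sup>+y\<in>G.
          ennreal (\<bar>u x - u y\<bar> powr p / norm (x - y) powr (real CARD('n) + s * p))
          \<partial>lebesgue) \<partial>lebesgue)
       (1 / p)"

definition Cc :: "(real ^ 'n) set \<Rightarrow> (real ^ 'n \<Rightarrow> real) set" where
  "Cc G = {u. continuous_on G u
              \<and> compact (closure {x \<in> G. u x \<noteq> 0})
              \<and> closure {x \<in> G. u x \<noteq> 0} \<subseteq> G}"

definition capacity ::
    "real \<Rightarrow> real \<Rightarrow> (real ^ 'n) set \<Rightarrow> (real ^ 'n) set \<Rightarrow> ennreal" where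
  "capacity s p K G =
     (INF u \<in> {u \<in> Cc G. \<forall>x\<in>K. u x \<ge> 1}. ennreal_powr (sobolev_seminorm s p G u) p)"

definition zero_extension ::
    "(real ^ 'n) set \<Rightarrow> (real ^ 'n \<Rightarrow> real) \<Rightarrow> real ^ 'n \<Rightarrow> real" where
  "zero_extension G u = (\<lambda>x. if x \<in> G then u x else 0)"

definition admits_zero_extension :: "real \<Rightarrow> real \<Rightarrow> (real ^ 'n) set \<Rightarrow> bool" where
  "admits_zero_extension s p G \<longleftrightarrow>
     (\<exists>C::real. C > 0 \<and> (\<forall>u \<in> Cc G.
        sobolev_seminorm s p UNIV (zero_extension G u) \<le> ennreal C * sobolev_seminorm s p G u))"

(* Side length 2 ^ k with k an arbitrary integer, corners in the lattice 2 ^ k * Z^n. *)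
definition dyadic_cube :: "(real ^ 'n) set \<Rightarrow> bool" where
  "dyadic_cube Q \<longleftrightarrow>
     (\<exists>(k::int) (m::int ^ 'n).
        Q = cbox (\<chi> i. 2 powi k * of_int (m $ i)) (\<chi> i. 2 powi k * (of_int (m $ i) + 1)))"

(* The centre of a nonempty box cbox a b is the midpoint of a and b. *)
definition concentric_dilation :: "real \<Rightarrow> (real ^ 'n) set \<Rightarrow> (real ^ 'n) set" where
  "concentric_dilation t Q =
     (let c = midpoint (interval_lowerbound Q) (interval_upperbound Q)
      in (\<lambda>x. c + t *\<^sub>R (x - c)) ` Q)"

(* C is the bound on the overlap of the dilated cubes. *)
definition whitney_decomposition ::
    "real \<Rightarrow> (real ^ 'n) set \<Rightarrow> (real ^ 'n) set set \<Rightarrow> bool" where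
  "whitney_decomposition C G W \<longleftrightarrow>
     (\<forall>Q\<in>W. dyadic_cube Q) \<and>
     pairwise (\<lambda>Q R. interior Q \<inter> interior R = {}) W \<and>
     G = \<Union>W \<and>
     (\<forall>Q\<in>W. diameter Q \<le> setdist Q (frontier G) \<and> setdist Q (frontier G) \<le> 4 * diameter Q) \<and>
     (\<forall>x. (\<Sum>\<^sub>\<infinity>Q\<in>W. indicator (concentric_dilation (9 / 8) Q) x) \<le> ennreal C * indicator G x)"

definition quasiadditive ::
    "real \<Rightarrow> real \<Rightarrow> (real ^ 'n) set set \<Rightarrow> (real ^ 'n) set \<Rightarrow> bool" where
  "quasiadditive s p W G \<longleftrightarrow>
     (\<exists>N::real. N > 0 \<and> (\<forall>K. compact K \<and> K \<subseteq> G \<longrightarrow>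
        (\<Sum>\<^sub>\<infinity>Q\<in>W. capacity s p (K \<inter> Q) G) \<le> ennreal N * capacity s p K G))"

end

theory Submission
  imports Defs
begin

text \<open>
  For \<open>sp < 1\<close> the boundary of the cube is invisible to the intrinsic seminorm. Let \<open>u\<^sub>r\<close> be the
  cutoff that vanishes within distance \<open>r\<close> of the complement, equals 1 from distance \<open>2r\<close> on, and
  is \<open>1/r\<close>-Lipschitz. A pair \<open>(x, y)\<close> contributes to its energy only if one of the points lies in a
  collar of measure \<open>O(r)\<close>, and each point of the collar contributes at most
  \<open>\<integral> min(1, |h|/r)\<^sup>p |h|\<^sup>-\<^sup>n\<^sup>-\<^sup>s\<^sup>p dh = O(r\<^sup>-\<^sup>s\<^sup>p)\<close>, so the energy is \<open>O(r\<^sup>1\<^sup>-\<^sup>s\<^sup>p)\<close> and tends to 0.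
  Hence every compact subset of the cube has capacity zero, and quasiadditivity is trivial.
  The zero extensions of the \<open>u\<^sub>r\<close>, on the other hand, jump from 1 on a fixed inner cube to 0 on a
  fixed cube outside, which keeps their energy over the whole space away from 0.
\<close>

section \<open>Integral of the truncated kernel over dyadic shells\<close>

lemma ex_dyadic_interval:
  fixes t :: real
  assumes "1 \<le> t"
  obtains k :: nat where "2 ^ k \<le> t" "t \<le> 2 ^ Suc k"
proof -
  define k where "k = (LEAST k. t \<le> 2 ^ Suc k)"
  obtain j :: nat where "t < 2 ^ j"
    using real_arch_pow[of 2 t] by auto
  then have "t \<le> 2 ^ Suc j"
    using power_increasing[of j "Suc j" "2::real"] by linarith
  then have upper: "t \<le> 2 ^ Suc k"
    unfolding k_def by (rule LeastI)
  \<comment> \<open>Minimality of \<open>k\<close> rules out its predecessor; for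
    \<open>k = 0\<close> the bound is the hypothesis \<open>1 \<le> t\<close>.\<close>
  have "2 ^ k \<le> t"
  proof (cases k)
    case (Suc i)
    then have "\<not> t \<le> 2 ^ Suc i"
      using not_less_Least[of i "\<lambda>k. t \<le> 2 ^ Suc k"] by (simp add: k_def)
    then show ?thesis using Suc by simp
  qed (use assms in simp)
  with upper that show thesis by blast
qed

lemma le_suminf_ennreal: "f k \<le> (\<Sum>k. f k :: ennreal)"
  using sum_le_suminf[OF summableI, of "{k}" f] by simp

lemma suminf_ennreal_geometric:
  assumes "0 \<le> A" "0 \<le> x" "x < 1"
  shows "(\<Sum>k. ennreal (A * x ^ k)) = ennreal (A / (1 - x))"
  using assms sums_mult[OF geometric_sums[of x], of A]
  by (intro suminf_ennreal_eq) (auto simp: divide_inverse)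

text \<open>
  On the dyadic shells \<open>|h| \<approx> 2\<^sup>-\<^sup>k r\<close> and \<open>|h| \<approx> 2\<^sup>k r\<close> the integrals decay geometrically, with ratios
  \<open>2 powr (a - p)\<close> and \<open>2 powr (- a)\<close>.
\<close>
lemma nn_integral_truncated_kernel_le:
  fixes a p :: real
  assumes "0 < a" "a < p"
  obtains C :: real where "0 \<le> C"
    "\<And>r. 0 < r \<Longrightarrow>
      (\<integral>\<^sup>+h. ennreal (min 1 (norm (h::'a::euclidean_space) / r) powr p / norm h powr (real DIM('a) + a)) \<partial>lborel)
        \<le> ennreal (C * r powr (- a))"
proof -
  define n where "n = DIM('a)"
  define e where "e = real n + a"
  define V where "V = unit_ball_vol (real n)"
  define x where "x = (2::real) powr (a - p)"
  define y where "y = (2::real) powr (- a)"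
  have V: "0 \<le> V" by (simp add: V_def)
  have xy: "0 \<le> x" "x < 1" "0 \<le> y" "y < 1"
    using assms powr_less_mono[of "a - p" 0 "2::real"] powr_less_mono[of "- a" 0 "2::real"]
    by (simp_all add: x_def y_def)
  define C where "C = V * 2 powr e / (1 - x) + V * 2 powr n / (1 - y)"
  have C: "0 \<le> C" using V xy by (simp add: C_def)
  moreover have "(\<integral>\<^sup>+h. ennreal (min 1 (norm (h::'a) / r) powr p / norm h powr e) \<partial>lborel)
        \<le> ennreal (C * r powr (- a))" if r: "0 < r" for r
  proof -
    \<comment> \<open>\<open>c k\<close> bounds the kernel on the shell with radii
      \<open>r / 2 ^ Suc k\<close> and \<open>r / 2 ^ k\<close>: numerator taken at the outer
      radius, denominator at the inner one. \<open>d k\<close> does the same on the shell with radii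
      \<open>r * 2 ^ k\<close> and \<open>r * 2 ^ Suc k\<close>, where the numerator is 1. Below,
      each shell is enlarged to the full ball, which changes the volume only by a constant
      factor.\<close>
    define c where "c k = ((1 / 2) ^ k) powr p * (r * (1 / 2) ^ Suc k) powr - e" for k :: nat
    define d where "d k = (r * 2 ^ k) powr - e" for k :: nat
    have kernel_le: "ennreal (min 1 (norm h / r) powr p / norm h powr e)
      \<le> (\<Sum>k. ennreal (c k) * indicator (cball 0 (r * (1 / 2) ^ k)) h) +
        (\<Sum>k. ennreal (d k) * indicator (cball 0 (r * 2 ^ Suc k)) h)"
      (is "?g \<le> (\<Sum>k. ?F k) + (\<Sum>k. ?H k)") for h :: 'a
    proof -
      consider "h = 0" | "h \<noteq> 0" "norm h \<le> r" | "h \<noteq> 0" "r \<le> norm h" by linarith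
      then show ?thesis
      proof cases
        \<comment> \<open>At the origin the integrand is 0 / 0, hence 0.\<close>
        case 1
        then show ?thesis by simp
      next
        case 2
        then have "1 \<le> r / norm h" by simp
        then obtain k :: nat where k: "2 ^ k \<le> r / norm h" "r / norm h \<le> 2 ^ Suc k"
          by (rule ex_dyadic_interval)
        then have le: "norm h \<le> r * (1 / 2) ^ k" and ge: "r * (1 / 2) ^ Suc k \<le> norm h"
          using 2 by (simp_all add: field_simps)
        have "min 1 (norm h / r) powr p / norm h powr e =
            min 1 (norm h / r) powr p * norm h powr - e"
          by (simp add: powr_minus[of _ "e"] divide_inverse )
        also have "\<dots> \<le> c k"
          unfolding c_def
        proof (intro mult_mono)
          show "min 1 (norm h / r) powr p \<le> ((1 / 2) ^ k) powr p"
            using le r assms 2 by (intro powr_mono2) (auto simp: field_simps)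
          show "norm h powr - e \<le> (r * (1 / 2) ^ Suc k) powr - e"
            using ge r assms by (intro powr_mono2') (auto simp: e_def)
        qed auto
        finally have "?g \<le> ?F k"
          using le by (simp add: ennreal_leI)
        also have "?F k \<le> (\<Sum>k. ?F k)" by (rule le_suminf_ennreal)
        also have "\<dots> \<le> (\<Sum>k. ?F k) + (\<Sum>k. ?H k)" by simp
        finally show ?thesis .
      next
        case 3
        then have ge1: "1 \<le> norm h / r" using r by simp
        then obtain k :: nat where k: "2 ^ k \<le> norm h / r" "norm h / r \<le> 2 ^ Suc k"
          by (rule ex_dyadic_interval)
        then have ge: "r * 2 ^ k \<le> norm h" and le: "norm h \<le> r * 2 ^ Suc k"
          using r by (simp_all add: field_simps)
        have "min 1 (norm h / r) powr p / norm h powr e = norm h powr - e"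
          using ge1 by (simp add: powr_minus_divide[of _ "e"] min_absorb1 )
        also have "\<dots> \<le> d k"
          unfolding d_def using ge r assms by (intro powr_mono2') (auto simp: e_def)
        finally have "?g \<le> ?H k"
          using le by (simp add: ennreal_leI)
        also have "?H k \<le> (\<Sum>k. ?H k)" by (rule le_suminf_ennreal)
        also have "\<dots> \<le> (\<Sum>k. ?F k) + (\<Sum>k. ?H k)" by simp
        finally show ?thesis .
      qed
    qed
    \<comment> \<open>With \<open>q = (1 / 2) ^ k\<close> the total power of \<open>q\<close> is p -
      e + n = p - a, so the terms decay because \<open>a < p\<close>. The factor
      \<open>2 powr e\<close> comes from measuring the denominator at half the radius.\<close>
    have inner: "c k * (V * (r * (1 / 2) ^ k) ^ n) = V * 2 powr e * r powr - a * x ^ k" for k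
    proof -
      define q where "q = ((1::real) / 2) ^ k"
      have q: "0 < q" by (simp add: q_def)
      have "(1 / 2) powr - e = (2::real) powr e"
        using powr_powr[of "2::real" "-1" "- e"] by (simp add: powr_minus_divide)
      moreover have "r * (1 / 2) ^ Suc k = (r * q) * (1 / 2)"
        by (simp add: q_def)
      ultimately have "c k = q powr p * ((r * q) powr - e * 2 powr e)"
        using r q powr_mult[of "r * q" "1 / 2" "- e"] by (simp only: c_def q_def[symmetric])
      then have "c k * (r * q) ^ n = 2 powr e * (q powr p * ((r * q) powr - e * (r * q) powr n))"
        using r q by (simp only: powr_realpow mult_pos_pos mult_ac)
      also have "(r * q) powr - e * (r * q) powr n = (r * q) powr - a"
        by (simp add: powr_add[symmetric] e_def del: powr_mult)
      also have "\<dots> = r powr - a * q powr - a"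
        using r q by (simp add: powr_mult)
      also have "q powr p * (r powr - a * q powr - a) = r powr - a * q powr (p - a)"
        by (simp add: powr_diff powr_minus divide_inverse)
      also have "q powr (p - a) = x ^ k"
      proof -
        have "q = 2 powr (- real k)"
          by (simp add: q_def powr_minus_divide powr_realpow power_one_over)
        then show ?thesis
          by (simp add: x_def powr_powr powr_power algebra_simps)
      qed
      finally show ?thesis by (simp add: q_def)
    qed
    \<comment> \<open>Here the power of \<open>q = 2 ^ k\<close> is - e + n = - a, so the decay
      comes from \<open>0 < a\<close>; \<open>2 powr n\<close> is the cost of the ball of twice the
      radius.\<close>
    have outer: "d k * (V * (r * 2 ^ Suc k) ^ n) = V * 2 powr n * r powr - a * y ^ k" for k
    proof -
      define q where "q = (2::real) ^ k"
      have q: "0 < q" by (simp add: q_def)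
      have "(r * 2 ^ Suc k) ^ n = 2 powr n * (r * q) powr n"
        using r q by (simp add: q_def powr_realpow power_mult_distrib)
      then have "d k * (r * 2 ^ Suc k) ^ n = 2 powr n * ((r * q) powr - e * (r * q) powr n)"
        by (simp only: d_def q_def[symmetric] mult_ac)
      also have "(r * q) powr - e * (r * q) powr n = (r * q) powr - a"
        by (simp add: powr_add[symmetric] e_def del: powr_mult)
      also have "\<dots> = r powr - a * q powr - a"
        using r q by (simp add: powr_mult)
      also have "q powr - a = y ^ k"
        by (simp add: q_def y_def powr_realpow[symmetric] powr_powr powr_power mult.commute)
      finally show ?thesis by simp
    qed
    have "(\<integral>\<^sup>+h. ennreal (min 1 (norm (h::'a) / r) powr p / norm h powr e) \<partial>lborel)
      \<le> (\<integral>\<^sup>+h. (\<Sum>k. ennreal (c k) * indicator (cball 0 (r * (1 / 2) ^ k)) h) +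
        (\<Sum>k. ennreal (d k) * indicator (cball 0 (r * 2 ^ Suc k)) (h::'a)) \<partial>lborel)"
      by (intro nn_integral_mono kernel_le)
    also have "\<dots> = (\<Sum>k. ennreal (c k) * emeasure lborel (cball (0::'a) (r * (1 / 2) ^ k))) +
        (\<Sum>k. ennreal (d k) * emeasure lborel (cball (0::'a) (r * 2 ^ Suc k)))"
    proof -
      have meas: "(\<lambda>h. ennreal (w k) * indicator (cball (0::'a) (\<rho> k)) h) \<in> borel_measurable lborel"
        for w \<rho> :: "nat \<Rightarrow> real" and k
        by (auto intro!: borel_measurable_times_ennreal borel_measurable_indicator)
      have eq: "(\<integral>\<^sup>+h. (\<Sum>k. ennreal (w k) * indicator (cball (0::'a) (\<rho> k)) h) \<partial>lborel)
          = (\<Sum>k. ennreal (w k) * emeasure lborel (cball (0::'a) (\<rho> k)))" for w \<rho> :: "nat \<Rightarrow> real"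
        by (subst nn_integral_suminf[OF meas]) (simp add: nn_integral_cmult_indicator)
      show ?thesis
        by (subst nn_integral_add) (rule borel_measurable_suminf_order meas | simp only: eq)+
    qed
    also have "\<dots> = (\<Sum>k. ennreal (V * 2 powr e * r powr - a * x ^ k)) +
        (\<Sum>k. ennreal (V * 2 powr n * r powr - a * y ^ k))"
      using r V by (simp add: emeasure_cball n_def[symmetric] V_def[symmetric] ennreal_mult''[symmetric]
          inner[symmetric] outer[symmetric] del: power_Suc)
    also have "\<dots> = ennreal (V * 2 powr e * r powr - a / (1 - x)) + ennreal (V * 2 powr n * r powr - a / (1 - y))"
      using V xy by (subst (1 2) suminf_ennreal_geometric) auto
    also have "\<dots> = ennreal (C * r powr - a)"
      using V xy by (simp add: C_def ring_distribs flip: ennreal_plus)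
    finally show ?thesis .
  qed
  ultimately show thesis
    using that by (simp add: n_def e_def)
qed

section \<open>Energy of a function that is constant off a small set\<close>

lemma nn_integral_lborel_diff:
  fixes f :: "'a::euclidean_space \<Rightarrow> ennreal"
  assumes "f \<in> borel_measurable borel"
  shows "(\<integral>\<^sup>+y. f (y - x) \<partial>lborel) = (\<integral>\<^sup>+y. f y \<partial>lborel)"
  using assms by (subst (2) lborel_distr_plus[of "- x", symmetric]) (simp add: nn_integral_distr)

text \<open>A pair contributes only if one of its points lies in \<open>A\<close>, and the two
  possibilities are symmetric, whence the factor 2. The pointwise bound passes to Borel functions of
  the difference first, so Tonelli and translation invariance are applied only to those.\<close>

lemma nn_integral_collar_le:
  fixes u :: "'a::euclidean_space \<Rightarrow> real"
  assumes A: "A \<in> sets borel"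
    and lip: "\<And>x y. \<bar>u x - u y\<bar> \<le> min 1 (norm (x - y) / r)"
    and const: "\<And>x. x \<in> G - A \<Longrightarrow> u x = c"
    and p: "0 \<le> p"
  shows "(\<integral>\<^sup>+x\<in>G. (\<integral>\<^sup>+y\<in>G. ennreal (\<bar>u x - u y\<bar> powr p / norm (x - y) powr q) \<partial>lborel) \<partial>lborel)
    \<le> 2 * emeasure lborel A * (\<integral>\<^sup>+h. ennreal (min 1 (norm (h::'a) / r) powr p / norm h powr q) \<partial>lborel)"
proof -
  define g where "g h = ennreal (min 1 (norm h / r) powr p / norm h powr q)" for h :: 'a
  have [measurable]: "g \<in> borel_measurable borel" unfolding g_def by measurable
  note A[measurable]
  have le: "ennreal (\<bar>u x - u y\<bar> powr p / norm (x - y) powr q) * indicator G y * indicator G x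
      \<le> indicator A x * g (y - x) + indicator A y * g (y - x)" for x y
  proof (cases "x \<in> G \<and> y \<in> G \<and> (x \<in> A \<or> y \<in> A)")
    case True
    have "ennreal (\<bar>u x - u y\<bar> powr p / norm (x - y) powr q) \<le> g (y - x)"
      unfolding g_def using lip[of x y] p
      by (intro ennreal_leI) (auto simp: norm_minus_commute intro!: divide_right_mono powr_mono2)
    with True show ?thesis
      by (auto simp: indicator_def intro: order_trans)
  next
    case False
    then have "indicator G y * indicator G x = (0::ennreal) \<or> u x = u y"
      using const[of x] const[of y] by (auto simp: indicator_def)
    then show ?thesis by (auto simp: mult.assoc)
  qed
  have "(\<integral>\<^sup>+x\<in>G. (\<integral>\<^sup>+y\<in>G. ennreal (\<bar>u x - u y\<bar> powr p / norm (x - y) powr q) \<partial>lborel) \<partial>lborel)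
      \<le> (\<integral>\<^sup>+x. (\<integral>\<^sup>+y. indicator A x * g (y - x) + indicator A y * g (y - x) \<partial>lborel) \<partial>lborel)"
  proof (rule nn_integral_mono)
    fix x
    have "(\<integral>\<^sup>+y\<in>G. ennreal (\<bar>u x - u y\<bar> powr p / norm (x - y) powr q) \<partial>lborel) * indicator G x
      \<le> (\<integral>\<^sup>+y. ennreal (\<bar>u x - u y\<bar> powr p / norm (x - y) powr q) * indicator G y * indicator G x \<partial>lborel)"
      by (cases "x \<in> G") simp_all
    also have "\<dots> \<le> (\<integral>\<^sup>+y. indicator A x * g (y - x) + indicator A y * g (y - x) \<partial>lborel)"
      by (intro nn_integral_mono le)
    finally show "(\<integral>\<^sup>+y\<in>G. ennreal (\<bar>u x - u y\<bar> powr p / norm (x - y) powr q) \<partial>lborel) * indicator G x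
      \<le> \<dots>" .
  qed
  also have "\<dots> = (\<integral>\<^sup>+x. (\<integral>\<^sup>+y. indicator A x * g (y - x) \<partial>lborel) \<partial>lborel)
      + (\<integral>\<^sup>+x. (\<integral>\<^sup>+y. indicator A y * g (y - x) \<partial>lborel) \<partial>lborel)"
    by (simp add: nn_integral_add)
  \<comment> \<open>Swapping the integrals and using that \<open>g\<close> is even turns the second
    term into a copy of the first.\<close>
  also have "(\<integral>\<^sup>+x. (\<integral>\<^sup>+y. indicator A y * g (y - x) \<partial>lborel) \<partial>lborel)
      = (\<integral>\<^sup>+y. (\<integral>\<^sup>+x. indicator A y * g (y - x) \<partial>lborel) \<partial>lborel)"
    by (rule lborel_pair.Fubini'[symmetric]) measurable
  also have "\<dots> = (\<integral>\<^sup>+y. (\<integral>\<^sup>+x. indicator A y * g (x - y) \<partial>lborel) \<partial>lborel)"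
    by (simp add: g_def norm_minus_commute)
  also have "(\<integral>\<^sup>+x. (\<integral>\<^sup>+y. indicator A x * g (y - x) \<partial>lborel) \<partial>lborel) = emeasure lborel A * (\<integral>\<^sup>+h. g h \<partial>lborel)"
    using A by (simp add: nn_integral_cmult nn_integral_lborel_diff nn_integral_multc)
  finally show ?thesis
    by (simp add: g_def mult_2 distrib_right)
qed

section \<open>The seminorm as a power of a Borel energy\<close>

definition gagliardo_energy :: "real \<Rightarrow> real \<Rightarrow> (real ^ 'n) set \<Rightarrow> (real ^ 'n \<Rightarrow> real) \<Rightarrow> ennreal" where
  "gagliardo_energy s p G u =
     (\<integral>\<^sup>+x\<in>G. (\<integral>\<^sup>+y\<in>G.
        ennreal (\<bar>u x - u y\<bar> powr p / norm (x - y) powr (real CARD('n) + s * p)) \<partial>lborel) \<partial>lborel)"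

text \<open>\<open>lebesgue\<close> is the completion of \<open>lborel\<close>, and completing a
  measure does not change nonnegative integrals. This allows Borel measurability and Tonelli to be
  used from here on.\<close>

lemma sobolev_seminorm_eq: "sobolev_seminorm s p G u = ennreal_powr (gagliardo_energy s p G u) (1 / p)"
  by (simp add: sobolev_seminorm_def gagliardo_energy_def nn_integral_completion)

lemma ennreal_powr_mono: "a \<le> b \<Longrightarrow> 0 \<le> r \<Longrightarrow> ennreal_powr a r \<le> ennreal_powr b r"
  by (auto simp: ennreal_powr_def top_unique less_top intro!: ennreal_leI powr_mono2 enn2real_mono)

lemma ennreal_powr_ennreal: "0 \<le> a \<Longrightarrow> ennreal_powr (ennreal a) r = ennreal (a powr r)"
  by (simp add: ennreal_powr_def)

lemma ennreal_powr_inverse: "0 < p \<Longrightarrow> ennreal_powr (ennreal_powr a (1 / p)) p = a"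
  by (cases a rule: ennreal_cases) (simp_all add: ennreal_powr_def powr_powr)

section \<open>Cutoffs of the cube and their energy\<close>

definition cutoff :: "'a::metric_space set \<Rightarrow> real \<Rightarrow> 'a \<Rightarrow> real" where
  "cutoff G r x = max 0 (min 1 (infdist x (- G) / r - 1))"

lemma cutoff_lipschitz:
  assumes "0 < r"
  shows "\<bar>cutoff G r x - cutoff G r y\<bar> \<le> min 1 (dist x y / r)"
proof -
  have "\<bar>infdist x (- G) / r - infdist y (- G) / r\<bar> \<le> dist x y / r"
    using assms infdist_triangle_abs[of x "- G" y]
    by (simp add: divide_right_mono flip: diff_divide_distrib)
  then show ?thesis
    by (simp add: cutoff_def) linarith
qed

lemma cutoff_eq_1:
  assumes "0 < r" "2 * r \<le> infdist x (- G)"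
  shows "cutoff G r x = 1"
  using assms by (simp add: cutoff_def field_simps)

text \<open>The set of points at distance at least \<open>r\<close> from the complement is closed,
  lies in \<open>G\<close> since \<open>infdist\<close> vanishes on the complement, and contains
  every point where the cutoff is nonzero. Compactness of the support then follows from boundedness
  of \<open>G\<close>.\<close>

lemma cutoff_in_Cc:
  fixes G :: "(real ^ 'n) set"
  assumes "0 < r" "bounded G"
  shows "cutoff G r \<in> Cc G"
proof -
  have cont: "continuous_on S (cutoff G r)" for S
    using assms unfolding cutoff_def by (intro continuous_intros) auto
  let ?S = "{x. r \<le> infdist x (- G)}"
  have "closed ?S"
    by (intro closed_Collect_le continuous_intros)
  moreover have "?S \<subseteq> G"
    using assms by (force intro: ccontr)
  moreover have "{x \<in> G. cutoff G r x \<noteq> 0} \<subseteq> ?S"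
    using assms by (auto simp: cutoff_def max_def min_def field_simps split: if_splits)
  ultimately have "closure {x \<in> G. cutoff G r x \<noteq> 0} \<subseteq> G"
    by (meson closure_minimal order_trans)
  then show ?thesis
    using assms cont unfolding Cc_def by (auto intro: bounded_subset)
qed

text \<open>The inner cube has side 1 - 4r, so the collar has measure 1 - (1 - 4r)^n, and
  Bernoulli's inequality bounds this by 4nr. The assumption \<open>r \<le> 1 / 4\<close> keeps the
  side nonnegative.\<close>

lemma measure_cube_collar_le:
  fixes r :: real
  assumes "0 < r" "r \<le> 1 / 4"
  shows "emeasure lborel (box 0 1 - cbox (\<chi> i. 2 * r) (\<chi> i. 1 - 2 * r) :: (real ^ 'n) set)
    \<le> ennreal (4 * CARD('n) * r)"
proof -
  let ?Q = "cbox (\<chi> i. 2 * r) (\<chi> i. 1 - 2 * r) :: (real ^ 'n) set"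
  have Q: "emeasure lborel ?Q = ennreal ((1 - 4 * r) ^ CARD('n))"
  proof -
    have "?Q \<noteq> {}"
      using assms by (auto simp: interval_ne_empty_cart)
    then have "measure lborel ?Q = (1 - 4 * r) ^ CARD('n)"
      by (simp add: content_cbox_cart)
    then show ?thesis
      by (simp only: emeasure_eq_measure2[OF fmeasurable_cbox])
  qed
  have "cbox 0 1 \<noteq> ({} :: (real ^ 'n) set)"
    by (simp add: interval_ne_empty_cart)
  then have "measure lborel (cbox 0 1 :: (real ^ 'n) set) = 1"
    by (simp add: content_cbox_cart)
  then have "measure lborel (box 0 1 :: (real ^ 'n) set) = 1"
    by (simp only: measure_lborel_box_eq measure_lborel_cbox_eq)
  then have G: "emeasure lborel (box 0 1 :: (real ^ 'n) set) = ennreal 1"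
    by (simp only: emeasure_eq_measure2[OF fmeasurable_box])
  have "?Q \<subseteq> box 0 1"
    using assms by (simp add: subset_interval_cart)
  then have "emeasure lborel (box 0 1 - ?Q) = ennreal 1 - ennreal ((1 - 4 * r) ^ CARD('n))"
    by (subst emeasure_Diff) (auto simp: Q G)
  also have "\<dots> = ennreal (1 - (1 - 4 * r) ^ CARD('n))"
    using assms by (subst ennreal_minus) auto
  also have "\<dots> \<le> ennreal (4 * CARD('n) * r)"
    using Bernoulli_inequality[of "- 4 * r" "CARD('n)"] assms by (intro ennreal_leI) (simp add: algebra_simps)
  finally show ?thesis .
qed

lemma cutoff_eq_1_inner_cube:
  fixes x :: "real ^ 'n"
  assumes "0 < r" "x \<in> cbox (\<chi> i. 2 * r) (\<chi> i. 1 - 2 * r)"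
  shows "cutoff (box 0 1) r x = 1"
proof (rule cutoff_eq_1)
  \<comment> \<open>\<open>infdist\<close> is an infimum only for a nonempty set and is 0 by
    convention otherwise; the corner 1 shows that the complement is nonempty.\<close>
  have "1 \<in> - box 0 (1 :: real ^ 'n)" by (simp add: mem_box_cart)
  then have ne: "- box 0 (1 :: real ^ 'n) \<noteq> {}" by blast
  show "2 * r \<le> infdist x (- box 0 1)"
    unfolding infdist_notempty[OF ne]
  proof (rule cINF_greatest[OF ne])
    fix y :: "real ^ 'n" assume "y \<in> - box 0 1"
    then obtain i where "y $ i \<le> 0 \<or> 1 \<le> y $ i"
      by (auto simp: mem_box_cart not_less)
    moreover have "2 * r \<le> x $ i" "x $ i \<le> 1 - 2 * r"
      using assms(2) by (auto simp: mem_box_cart)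
    \<comment> \<open>One coordinate of \<open>y\<close> is outside (0,1), and the difference in
      that coordinate alone is already at least 2r.\<close>
    ultimately have "2 * r \<le> \<bar>x $ i - y $ i\<bar>" by linarith
    also have "\<dots> \<le> dist x y"
      using component_le_norm_cart[of "x - y" i] by (simp add: dist_norm)
    finally show "2 * r \<le> dist x y" .
  qed
qed fact

text \<open>The collar measure contributes a factor r and the kernel integral, with a = sp, a factor
  r^(-sp); \<open>s < 1\<close> gives a < p. \<open>C\<close> is fixed before \<open>r\<close>, so
  that \<open>r\<close> can later tend to 0.\<close>

lemma cutoff_energy_le:
  fixes s p :: real
  assumes "0 < s" "s < 1" "1 < p"
  obtains C where "0 \<le> C"
    "\<And>r. 0 < r \<Longrightarrow> r \<le> 1 / 4 \<Longrightarrow>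
      gagliardo_energy s p (box 0 (1 :: real ^ 'n)) (cutoff (box 0 1) r) \<le> ennreal (C * r powr (1 - s * p))"
proof -
  have "0 < s * p" "s * p < p" using assms by simp_all
  then obtain C where C: "0 \<le> C" and kernel: "\<And>r. 0 < r \<Longrightarrow>
      (\<integral>\<^sup>+h. ennreal (min 1 (norm (h :: real ^ 'n) / r) powr p / norm h powr (real DIM(real ^ 'n) + s * p)) \<partial>lborel)
        \<le> ennreal (C * r powr (- (s * p)))"
    using nn_integral_truncated_kernel_le[where 'a = "real ^ 'n", of "s * p" p] by blast
  have "gagliardo_energy s p (box 0 (1 :: real ^ 'n)) (cutoff (box 0 1) r)
      \<le> ennreal (8 * CARD('n) * C * r powr (1 - s * p))"
    if r: "0 < r" "r \<le> 1 / 4" for r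
  proof -
    let ?A = "box 0 1 - cbox (\<chi> i. 2 * r) (\<chi> i. 1 - 2 * r) :: (real ^ 'n) set"
    have "gagliardo_energy s p (box 0 (1 :: real ^ 'n)) (cutoff (box 0 1) r)
      \<le> 2 * emeasure lborel ?A * (\<integral>\<^sup>+h. ennreal (min 1 (norm (h :: real ^ 'n) / r) powr p / norm h powr (real CARD('n) + s * p)) \<partial>lborel)"
      unfolding gagliardo_energy_def
    proof (rule nn_integral_collar_le)
      show "?A \<in> sets borel" by simp
      show "\<bar>cutoff (box 0 1) r x - cutoff (box 0 1) r y\<bar> \<le> min 1 (norm (x - y) / r)" for x y :: "real ^ 'n"
        using cutoff_lipschitz[OF r(1), of "box 0 1" x y] by (simp only: dist_norm)
      show "cutoff (box 0 1) r x = 1" if "x \<in> box 0 1 - ?A" for x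
        using that r cutoff_eq_1_inner_cube[of r x] by blast
    qed (use assms in simp)
    also have "\<dots> \<le> 2 * ennreal (4 * CARD('n) * r) * ennreal (C * r powr (- (s * p)))"
      using kernel[OF r(1)] measure_cube_collar_le[OF r, where 'n = 'n] by (intro mult_mono) auto
    also have "\<dots> = ennreal (2 * (4 * CARD('n) * r) * (C * r powr (- (s * p))))"
      using r C by (subst (1 2) ennreal_mult) (simp_all flip: ennreal_mult)
    also have "2 * (4 * CARD('n) * r) * (C * r powr (- (s * p))) = 8 * CARD('n) * C * r powr (1 - s * p)"
      using r powr_add[of r 1 "- (s * p)"] by simp
    finally show ?thesis .
  qed
  moreover have "0 \<le> 8 * CARD('n) * C" using C by simp
  ultimately show thesis using that by blast
qed

text \<open>Both halves of the result rest on this: it makes the capacity vanish and supplies the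
  counterexample to zero extension.\<close>

lemma ex_test_function_small_energy:
  fixes K :: "(real ^ 'n) set" and s p \<epsilon> :: real
  assumes "0 < s" "s < 1" "1 < p" "s * p < 1"
    and K: "compact K" "K \<subseteq> box 0 1" and \<epsilon>: "0 < \<epsilon>"
  obtains u where "u \<in> Cc (box 0 1)" "\<And>x. x \<in> K \<Longrightarrow> 1 \<le> u x"
    "gagliardo_energy s p (box 0 1) u \<le> ennreal \<epsilon>"
proof -
  obtain C where C: "0 \<le> C" and energy: "\<And>r. 0 < r \<Longrightarrow> r \<le> 1 / 4 \<Longrightarrow>
      gagliardo_energy s p (box 0 (1 :: real ^ 'n)) (cutoff (box 0 1) r) \<le> ennreal (C * r powr (1 - s * p))"
    using cutoff_energy_le[OF assms(1-3), where 'n = 'n] by metis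
  \<comment> \<open>A compact set keeps a positive distance from the closed complement. The minimum
    is attained only for nonempty \<open>K\<close>; for empty \<open>K\<close> any positive
    \<open>d\<close> serves.\<close>
  obtain d where d: "0 < d" "\<And>x. x \<in> K \<Longrightarrow> d \<le> infdist x (- box 0 1)"
  proof (cases "K = {}")
    case False
    then obtain x where x: "x \<in> K" "\<And>y. y \<in> K \<Longrightarrow> infdist x (- box 0 1) \<le> infdist y (- box 0 1)"
      using continuous_attains_inf[OF K(1) False continuous_on_infdist[OF continuous_on_id]] by blast
    have "1 \<in> - box 0 (1 :: real ^ 'n)" by (simp add: mem_box_cart)
    then have "0 < infdist x (- box 0 1)"
      using x(1) K by (intro infdist_pos_not_in_closed) (auto simp: closed_Compl)
    with x that show thesis by blast
  qed (use that[of 1] in auto)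
  let ?\<beta> = "1 - s * p"
  \<comment> \<open>The three bounds serve the energy estimate, the value 1 on \<open>K\<close>, and
    the smallness: the last one solves (C + 1) r^(1 - sp) = \<epsilon>, with C + 1 in place of C to
    avoid dividing by 0.\<close>
  define r where "r = min (min (1 / 4) (d / 2)) ((\<epsilon> / (C + 1)) powr (1 / ?\<beta>))"
  have r: "0 < r" "r \<le> 1 / 4" "2 * r \<le> d"
    using d \<epsilon> C by (auto simp: r_def)
  have "r powr ?\<beta> \<le> ((\<epsilon> / (C + 1)) powr (1 / ?\<beta>)) powr ?\<beta>"
    using r assms by (intro powr_mono2) (auto simp: r_def)
  also have "\<dots> = \<epsilon> / (C + 1)"
    using assms C by (simp add: powr_powr)
  finally have "C * r powr ?\<beta> \<le> C * (\<epsilon> / (C + 1))"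
    using C by (rule mult_left_mono)
  also have "\<dots> \<le> \<epsilon>"
    using C \<epsilon> by (simp add: field_simps)
  finally have "gagliardo_energy s p (box 0 1) (cutoff (box 0 (1 :: real ^ 'n)) r) \<le> ennreal \<epsilon>"
    using energy[OF r(1,2)] by (meson ennreal_leI order_trans)
  moreover have "1 \<le> cutoff (box 0 1) r x" if "x \<in> K" for x
    using cutoff_eq_1[OF r(1), of x "box 0 1"] d(2)[OF that] r(3) by simp
  ultimately show thesis
    using that cutoff_in_Cc[OF r(1) bounded_box, of 0 1] by blast
qed

section \<open>Vanishing capacity\<close>

lemma capacity_cube_eq_0:
  fixes K :: "(real ^ 'n) set"
  assumes "0 < s" "s < 1" "1 < p" "s * p < 1" "compact K" "K \<subseteq> box 0 1"
  shows "capacity s p K (box 0 1) = 0"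
proof -
  have "capacity s p K (box 0 1) \<le> 0 + ennreal \<epsilon>" if \<epsilon>: "0 < \<epsilon>" for \<epsilon>
  proof -
    obtain u where u: "u \<in> Cc (box 0 1)" "\<And>x. x \<in> K \<Longrightarrow> 1 \<le> u x"
      and small: "gagliardo_energy s p (box 0 1) u \<le> ennreal \<epsilon>"
      using ex_test_function_small_energy[OF assms \<epsilon>] by metis
    have "capacity s p K (box 0 1) \<le> ennreal_powr (sobolev_seminorm s p (box 0 1) u) p"
      unfolding capacity_def using u by (intro INF_lower) auto
    also have "\<dots> = gagliardo_energy s p (box 0 1) u"
      using assms by (simp add: sobolev_seminorm_eq ennreal_powr_inverse)
    finally show ?thesis using small by simp
  qed
  then have "capacity s p K (box 0 1) \<le> 0"
    using ennreal_le_epsilon[of 0] by blast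
  then show ?thesis by simp
qed

section \<open>Failure of the zero extension\<close>

lemma zero_extension_energy_ge:
  fixes s p :: real
  assumes "1 < p" "0 < s"
  obtains c where "0 < c"
    "\<And>u :: real ^ 'n \<Rightarrow> real. (\<And>x. x \<in> cbox (\<chi> i. 1 / 4) (\<chi> i. 3 / 4) \<Longrightarrow> 1 \<le> u x) \<Longrightarrow>
      ennreal c \<le> gagliardo_energy s p UNIV (zero_extension (box 0 1) u)"
proof -
  let ?K = "cbox (\<chi> i. 1 / 4) (\<chi> i. 3 / 4) :: (real ^ 'n) set"
  let ?B = "cbox (\<chi> i. 2) (\<chi> i. 3) :: (real ^ 'n) set"
  define q where "q = real CARD('n) + s * p"
  \<comment> \<open>Coordinates of points of \<open>?K\<close> and \<open>?B\<close> differ by at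
    most 3, so the points are at distance at most 3n and \<open>w\<close> bounds the integrand below
    on \<open>?K \<times> ?B\<close>, independently of \<open>u\<close>.\<close>
  define w where "w = 1 / (3 * real CARD('n)) powr q"
  have q: "0 \<le> q" using assms by (simp add: q_def)
  have w: "0 < w" by (simp add: w_def)
  have K: "emeasure lborel ?K = ennreal (measure lborel ?K)" and B: "emeasure lborel ?B = ennreal (measure lborel ?B)"
    by (rule emeasure_eq_measure2[OF fmeasurable_cbox])+
  have "?K \<noteq> {}" "?B \<noteq> {}" by (simp_all add: interval_ne_empty_cart)
  then have pos: "0 < measure lborel ?K" "0 < measure lborel ?B"
    by (simp_all add: content_cbox_cart)
  have lower: "ennreal (w * measure lborel ?B * measure lborel ?K)
      \<le> gagliardo_energy s p UNIV (zero_extension (box 0 1) u)"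
    if u: "\<And>x. x \<in> ?K \<Longrightarrow> 1 \<le> u x" for u
  proof -
    let ?v = "zero_extension (box 0 1) u"
    have le: "ennreal w * indicator ?B y * indicator ?K x \<le> ennreal (\<bar>?v x - ?v y\<bar> powr p / norm (x - y) powr q)"
      for x y
    proof (cases "x \<in> ?K \<and> y \<in> ?B")
      case True
      then have x: "\<And>i. 1 / 4 \<le> x $ i \<and> x $ i \<le> 3 / 4" and y: "\<And>i. 2 \<le> y $ i \<and> y $ i \<le> 3"
        by (auto simp: mem_box_cart)
      have "x \<in> box 0 1"
        unfolding mem_box_cart
      proof (intro allI)
        fix i show "0 $ i < x $ i \<and> x $ i < 1 $ i" using x[of i] by simp
      qed
      moreover have "y \<notin> box 0 1"
        using y unfolding mem_box_cart by (metis less_le_trans not_less one_index one_le_numeral)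
      ultimately have "1 \<le> \<bar>?v x - ?v y\<bar>"
        using u[of x] True by (auto simp: zero_extension_def)
      moreover have "norm (x - y) \<le> 3 * real CARD('n)"
      proof -
        have "norm (x - y) \<le> (\<Sum>i\<in>UNIV. \<bar>(x - y) $ i\<bar>)" by (rule norm_le_l1_cart)
        also have "\<dots> \<le> (\<Sum>i\<in>(UNIV :: 'n set). 3)"
        proof (rule sum_mono)
          fix i show "\<bar>(x - y) $ i\<bar> \<le> 3" using x[of i] y[of i] by (auto simp: abs_if)
        qed
        finally show ?thesis by simp
      qed
      \<comment> \<open>The denominator must be positive here, since division by 0 would give 0 and
        break the lower bound.\<close>
      moreover have "x \<noteq> y" using \<open>x \<in> box 0 1\<close> \<open>y \<notin> box 0 1\<close> by blast
      ultimately have "w \<le> \<bar>?v x - ?v y\<bar> powr p / norm (x - y) powr q"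
        unfolding w_def using q assms by (intro frac_le powr_mono2 ge_one_powr_ge_zero) auto
      with True show ?thesis by (simp add: ennreal_leI)
    next
      case False
      then show ?thesis by (auto simp: indicator_def)
    qed
    have "ennreal (w * measure lborel ?B * measure lborel ?K)
        = (\<integral>\<^sup>+x. (\<integral>\<^sup>+y. ennreal w * indicator ?B y * indicator ?K x \<partial>lborel) \<partial>lborel)"
    proof -
      have "(\<integral>\<^sup>+y. ennreal w * indicator ?B y * indicator ?K x \<partial>lborel)
          = ennreal w * emeasure lborel ?B * indicator ?K x" for x
        by (simp only: nn_integral_multc nn_integral_cmult_indicator sets_lborel cbox_borel
            borel_measurable_times_ennreal borel_measurable_const borel_measurable_indicator)
      then have "(\<integral>\<^sup>+x. (\<integral>\<^sup>+y. ennreal w * indicator ?B y * indicator ?K x \<partial>lborel) \<partial>lborel)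
          = ennreal w * emeasure lborel ?B * emeasure lborel ?K"
        by (simp only: nn_integral_cmult_indicator sets_lborel cbox_borel)
      also have "\<dots> = ennreal (w * measure lborel ?B * measure lborel ?K)"
        using w pos unfolding K B by (simp only: ennreal_mult less_imp_le mult_nonneg_nonneg)
      finally show ?thesis by (rule sym)
    qed
    also have "\<dots> \<le> gagliardo_energy s p UNIV ?v"
      unfolding gagliardo_energy_def using le by (auto simp: q_def intro!: nn_integral_mono)
    finally show ?thesis .
  qed
  show thesis
  proof (rule that)
    show "0 < w * measure lborel ?B * measure lborel ?K" using w pos by simp
  qed (rule lower)
qed

lemma not_admits_zero_extension_cube:
  assumes "0 < s" "s < 1" "1 < p" "s * p < 1"
  shows "\<not> admits_zero_extension s p (box 0 (1 :: real ^ 'n))"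
proof
  assume "admits_zero_extension s p (box 0 (1 :: real ^ 'n))"
  then obtain C where C: "0 < C" and ext: "\<And>u. u \<in> Cc (box 0 (1 :: real ^ 'n)) \<Longrightarrow>
      sobolev_seminorm s p UNIV (zero_extension (box 0 1) u) \<le> ennreal C * sobolev_seminorm s p (box 0 1) u"
    unfolding admits_zero_extension_def by blast
  let ?K = "cbox (\<chi> i. 1 / 4) (\<chi> i. 3 / 4) :: (real ^ 'n) set"
  obtain c where c: "0 < c" and lower: "\<And>u :: real ^ 'n \<Rightarrow> real. (\<And>x. x \<in> ?K \<Longrightarrow> 1 \<le> u x) \<Longrightarrow>
      ennreal c \<le> gagliardo_energy s p UNIV (zero_extension (box 0 1) u)"
    using zero_extension_energy_ge[OF assms(3,1), where 'n = 'n] by metis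
  \<comment> \<open>An extension constant \<open>C\<close> would force c \<le> C^p \<epsilon>; this
    choice makes the right side c/2.\<close>
  define \<epsilon> where "\<epsilon> = c / (2 * C powr p)"
  have \<epsilon>: "0 < \<epsilon>" using c C by (simp add: \<epsilon>_def)
  have "?K \<subseteq> box 0 1"
    by (simp add: subset_interval_cart)
  then obtain u where u: "u \<in> Cc (box 0 1)" "\<And>x. x \<in> ?K \<Longrightarrow> 1 \<le> u x"
      and small: "gagliardo_energy s p (box 0 1) u \<le> ennreal \<epsilon>"
    using ex_test_function_small_energy[OF assms compact_cbox _ \<epsilon>] by metis
  have "ennreal (c powr (1 / p)) = ennreal_powr (ennreal c) (1 / p)"
    using c by (simp add: ennreal_powr_ennreal)
  also have "\<dots> \<le> sobolev_seminorm s p UNIV (zero_extension (box 0 1) u)"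
    unfolding sobolev_seminorm_eq using lower[OF u(2)] assms by (intro ennreal_powr_mono) auto
  also have "\<dots> \<le> ennreal C * sobolev_seminorm s p (box 0 1) u"
    by (rule ext[OF u(1)])
  also have "\<dots> \<le> ennreal C * ennreal_powr (ennreal \<epsilon>) (1 / p)"
    unfolding sobolev_seminorm_eq using small assms by (intro mult_left_mono ennreal_powr_mono) auto
  also have "\<dots> = ennreal (C * \<epsilon> powr (1 / p))"
    using C \<epsilon> by (simp add: ennreal_powr_ennreal ennreal_mult)
  finally have "c powr (1 / p) \<le> C * \<epsilon> powr (1 / p)"
    using C by (simp add: ennreal_le_iff)
  then have "(c powr (1 / p)) powr p \<le> (C * \<epsilon> powr (1 / p)) powr p"
    using assms by (intro powr_mono2) auto
  then have "c \<le> C powr p * \<epsilon>"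
    using assms c C \<epsilon> by (simp add: powr_powr powr_mult)
  also have "\<dots> = c / 2"
    using C by (simp add: \<epsilon>_def)
  finally show False using c by simp
qed

section \<open>Quasiadditivity\<close>

lemma quasiadditive_cube:
  fixes W :: "(real ^ 'n) set set"
  assumes "0 < s" "s < 1" "1 < p" "s * p < 1" and W: "whitney_decomposition C (box 0 1) W"
  shows "quasiadditive s p W (box 0 1)"
  unfolding quasiadditive_def
\<comment> \<open>Any positive constant serves: dyadic cubes are closed, so each
  \<open>K \<inter> Q\<close> is compact, has capacity 0, and the left side vanishes
  termwise.\<close>
proof (intro exI[of _ 1] conjI allI impI)
  fix K :: "(real ^ 'n) set" assume K: "compact K \<and> K \<subseteq> box 0 1"
  have "capacity s p (K \<inter> Q) (box 0 1) = 0" if "Q \<in> W" for Q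
  proof (rule capacity_cube_eq_0[OF assms(1-4)])
    have "closed Q"
      using W that by (force simp: whitney_decomposition_def dyadic_cube_def)
    then show "compact (K \<inter> Q)" using K by (blast intro: compact_Int_closed)
  qed (use K in blast)
  then have "(\<Sum>\<^sub>\<infinity>Q\<in>W. capacity s p (K \<inter> Q) (box 0 1)) = 0"
    by (rule infsum_0)
  then show "(\<Sum>\<^sub>\<infinity>Q\<in>W. capacity s p (K \<inter> Q) (box 0 1)) \<le> ennreal 1 * capacity s p K (box 0 1)"
    by simp
qed simp

theorem theorem8:
  fixes s p :: real and G :: "(real ^ 'n) set"
  assumes "0 < s" and "s < 1" and "1 < p" and "s * p < 1"
    and "G = {x. \<forall>i. 0 < x $ i \<and> x $ i < 1}"
  shows "\<not> admits_zero_extension s p G \<and>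
         (\<forall>C W. whitney_decomposition C G W \<longrightarrow> quasiadditive s p W G)"
proof -
  have "G = box 0 1"
    using assms(5) by (auto simp: mem_box_cart)
  then show ?thesis
    using not_admits_zero_extension_cube quasiadditive_cube assms(1-4) by blast
qed

end
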